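(* Let $J\subset\mathbb{R}$ be an open interval and $Y$ a Banach space. Let $f,g:J\to Y$ be functions such that $f$ is a right-sided antiderivative of $g$ over $J$. Assume that there is a set $T$ of Lebesgue measure zero such that $g$ is locally bounded on $J\setminus T$, in the sense that every point of $J$ has a neighborhood $U\subset J$ such that $g$ is bounded on $U\setminus T$. Then $g$ is Bochner summable on every closed bounded interval $[t_1,t_2]\subset J$, and $$\int_{t_1}^{t_2}g(u)\,du=f(t_2)-f(t_1)\quad\text{for all }t_1,t_2\in J.$$
   Context: Right-sided antiderivative: $f$ is a right-sided antiderivative of $g$ over $J$ if $f$ is continuous on $J$, the right-sided derivative $f'_r(t)=\lim_{h>0,\,h\to0}\frac1h(f(t+h)-f(t))$ exists in $Y$ at every $t\in J$, and there is a set $T_0$ of Lebesgue measure zero such that $f'_r(t)=g(t)$ for all $t\in J\setminus T_0$. The integral is the Bochner integral with respect to Lebesgue measure on $\mathbb{R}$ (equivalently, the integral generated by the length function on bounded intervals). A function $g$ is Bochner summable on a set $A\subset J$ if the function equal to $g$ on $A$ and to $0$ off $A$ is Bochner integrable. For $t_1\le t_2$, $\int_{t_1}^{t_2}g(u)\,du$ is the integral of $g$ over $[t_1,t_2]$; for $t_1>t_2$ it is minus the integral of $g$ over $[t_2,t_1]$. *)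

theory Defs
  imports "HOL-Analysis.Analysis"
begin

text \<open>
  The library predicate \<^const>\<open>has_bochner_integral\<close> only covers second countable (that is,
  separable) ranges. For an arbitrary Banach space the class of strongly measurable functions
  replaces that of the Borel measurable ones: \<open>f\<close> is Bochner integrable if it is the
  almost everywhere limit of integrable simple functions \<open>s i\<close> with
  \<open>\<integral> norm (f - s i) \<longlonglongrightarrow> 0\<close>, and its integral is then the limit of the integrals of the \<open>s i\<close>.
  As \<^term>\<open>lebesgue\<close> is complete, \<open>norm (f - s i)\<close> is measurable.
\<close>

definition has_bochner_integral_banach :: "(real \<Rightarrow> 'a::real_normed_vector) \<Rightarrow> 'a \<Rightarrow> bool" where
  "has_bochner_integral_banach f x \<longleftrightarrow>
    (\<exists>s. (\<forall>i. Bochner_Integration.simple_bochner_integrable lebesgue (s i)) \<and>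
         (AE t in lebesgue. (\<lambda>i. s i t) \<longlonglongrightarrow> f t) \<and>
         (\<lambda>i::nat. \<integral>\<^sup>+t. norm (f t - s i t) \<partial>lebesgue) \<longlonglongrightarrow> 0 \<and>
         (\<lambda>i. Bochner_Integration.simple_bochner_integral lebesgue (s i)) \<longlonglongrightarrow> x)"

definition bochner_summable_on :: "(real \<Rightarrow> 'a::real_normed_vector) \<Rightarrow> real set \<Rightarrow> bool" where
  "bochner_summable_on g A \<longleftrightarrow> (\<exists>x. has_bochner_integral_banach (\<lambda>t. if t \<in> A then g t else 0) x)"

definition bochner_integral_on :: "(real \<Rightarrow> 'a::real_normed_vector) \<Rightarrow> real set \<Rightarrow> 'a" where
  "bochner_integral_on g A = (THE x. has_bochner_integral_banach (\<lambda>t. if t \<in> A then g t else 0) x)"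

definition oriented_bochner_integral :: "real \<Rightarrow> real \<Rightarrow> (real \<Rightarrow> 'a::real_normed_vector) \<Rightarrow> 'a" where
  "oriented_bochner_integral t1 t2 g =
    (if t1 \<le> t2 then bochner_integral_on g {t1..t2} else - bochner_integral_on g {t2..t1})"

definition right_antiderivative_on ::
    "(real \<Rightarrow> 'a::real_normed_vector) \<Rightarrow> (real \<Rightarrow> 'a) \<Rightarrow> real set \<Rightarrow> bool" where
  "right_antiderivative_on f g J \<longleftrightarrow>
    continuous_on J f \<and>
    (\<exists>f'. (\<forall>t\<in>J. (f has_vector_derivative f' t) (at_right t)) \<and>
          (\<exists>T\<^sub>0 \<in> null_sets lebesgue. \<forall>t\<in>J - T\<^sub>0. f' t = g t))"

definition locally_bounded_off :: "(real \<Rightarrow> 'a::real_normed_vector) \<Rightarrow> real set \<Rightarrow> real set \<Rightarrow> bool" where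
  "locally_bounded_off g J T \<longleftrightarrow>
    (\<forall>t\<in>J. \<exists>U. open U \<and> t \<in> U \<and> U \<subseteq> J \<and> bounded (g ` (U - T)))"


subsection \<open>Sanity checks\<close>

text \<open>The right-sided derivative is the limit of the right-sided difference quotients.\<close>

lemma has_vector_derivative_at_right_iff:
  fixes f :: "real \<Rightarrow> 'a::real_normed_vector"
  shows "(f has_vector_derivative D) (at_right t) \<longleftrightarrow>
    ((\<lambda>h. (1 / h) *\<^sub>R (f (t + h) - f t)) \<longlongrightarrow> D) (at_right 0)"
proof -
  have "(f has_vector_derivative D) (at_right t) \<longleftrightarrow>
      ((\<lambda>y. (1 / norm (y - t)) *\<^sub>R (f y - (f t + (y - t) *\<^sub>R D))) \<longlongrightarrow> 0) (at_right t)"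
    unfolding has_vector_derivative_def has_derivative_within
    by (simp add: bounded_linear_scaleR_left)
  also have "\<dots> \<longleftrightarrow> ((\<lambda>h. (1 / h) *\<^sub>R (f (t + h) - f t) - D) \<longlongrightarrow> 0) (at_right 0)"
    unfolding at_right_to_0[of t] filterlim_filtermap
    by (intro filterlim_cong refl eventually_mono[OF eventually_at_right_less])
       (auto simp: algebra_simps)
  also have "\<dots> \<longleftrightarrow> ((\<lambda>h. (1 / h) *\<^sub>R (f (t + h) - f t)) \<longlongrightarrow> D) (at_right 0)"
    by (rule Lim_null[symmetric])
  finally show ?thesis .
qed

lemma simple_bochner_integrable_borel_measurable:
  "Bochner_Integration.simple_bochner_integrable M s \<Longrightarrow> s \<in> borel_measurable M"
  by (auto intro: borel_measurable_simple_function elim: simple_bochner_integrable.cases)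

lemma borel_measurable_lebesgue_AE:
  fixes f g :: "real \<Rightarrow> 'a::topological_space"
  assumes g: "g \<in> borel_measurable lebesgue" and eq: "AE t in lebesgue. f t = g t"
  shows "f \<in> borel_measurable lebesgue"
proof (rule measurableI)
  fix A :: "'a set" assume A: "A \<in> sets borel"
  have gA: "g -` A \<inter> space lebesgue \<in> sets lebesgue"
    by (rule measurable_sets[OF g A])
  have "AE t in lebesgue. t \<in> g -` A \<inter> space lebesgue \<longleftrightarrow> t \<in> f -` A \<inter> space lebesgue"
    using eq by eventually_elim auto
  then show "f -` A \<inter> space lebesgue \<in> sets lebesgue"
    using gA by (rule completion.in_sets_AE) auto
qed simp

lemma AE_lim_borel_measurable_norm_diff:
  fixes f :: "real \<Rightarrow> 'a::real_normed_vector"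
  assumes s: "\<And>i. Bochner_Integration.simple_bochner_integrable lebesgue (s i)"
    and lim: "AE t in lebesgue. (\<lambda>i. s i t) \<longlonglongrightarrow> f t"
    and u: "Bochner_Integration.simple_bochner_integrable lebesgue u"
  shows "(\<lambda>t. norm (f t - u t)) \<in> borel_measurable lebesgue"
proof -
  have [measurable]: "(\<lambda>t. norm (s i t - u t)) \<in> borel_measurable lebesgue" for i
    using simple_bochner_integrable_compose2[OF _ s u, of "\<lambda>x y. norm (x - y)"]
    by (auto intro: simple_bochner_integrable_borel_measurable)
  define l where "l t = lim (\<lambda>i. norm (s i t - u t))" for t
  have l: "l \<in> borel_measurable lebesgue"
    unfolding l_def by measurable
  have "AE t in lebesgue. norm (f t - u t) = l t"
    using lim by eventually_elim (auto simp: l_def intro!: limI[symmetric] tendsto_intros)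
  then show ?thesis
    by (rule borel_measurable_lebesgue_AE[OF l])
qed

text \<open>The integral is well defined.\<close>

lemma has_bochner_integral_banach_unique:
  assumes "has_bochner_integral_banach f x" and "has_bochner_integral_banach f y"
  shows "x = y"
proof -
  obtain s where s: "\<And>i. Bochner_Integration.simple_bochner_integrable lebesgue (s i)"
      "AE t in lebesgue. (\<lambda>i. s i t) \<longlonglongrightarrow> f t"
      "(\<lambda>i::nat. \<integral>\<^sup>+t. norm (f t - s i t) \<partial>lebesgue) \<longlonglongrightarrow> 0"
      "(\<lambda>i. Bochner_Integration.simple_bochner_integral lebesgue (s i)) \<longlonglongrightarrow> x"
    using assms(1) by (auto simp: has_bochner_integral_banach_def)
  obtain u where u: "\<And>i. Bochner_Integration.simple_bochner_integrable lebesgue (u i)"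
      "(\<lambda>i::nat. \<integral>\<^sup>+t. norm (f t - u i t) \<partial>lebesgue) \<longlonglongrightarrow> 0"
      "(\<lambda>i. Bochner_Integration.simple_bochner_integral lebesgue (u i)) \<longlonglongrightarrow> y"
    using assms(2) by (auto simp: has_bochner_integral_banach_def)
  let ?S = "\<lambda>i. Bochner_Integration.simple_bochner_integral lebesgue (s i)"
  let ?U = "\<lambda>i. Bochner_Integration.simple_bochner_integral lebesgue (u i)"
  have bound: "ennreal (norm (?S i - ?U i)) \<le>
      (\<integral>\<^sup>+t. norm (f t - s i t) \<partial>lebesgue) + (\<integral>\<^sup>+t. norm (f t - u i t) \<partial>lebesgue)" for i
  proof -
    have "norm (?S i - ?U i) = norm (Bochner_Integration.simple_bochner_integral lebesgue (\<lambda>t. s i t - u i t))"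
      using s u by (subst simple_bochner_integral_diff) auto
    also have "\<dots> \<le> Bochner_Integration.simple_bochner_integral lebesgue (\<lambda>t. norm (s i t - u i t))"
      using simple_bochner_integrable_compose2[of "(-)" lebesgue "s i" "u i"] s u
      by (auto intro!: simple_bochner_integral_norm_bound)
    finally have "ennreal (norm (?S i - ?U i)) \<le>
        ennreal (Bochner_Integration.simple_bochner_integral lebesgue (\<lambda>t. norm (s i t - u i t)))"
      by (rule ennreal_leI)
    also have "\<dots> = (\<integral>\<^sup>+t. norm (s i t - u i t) \<partial>lebesgue)"
      using simple_bochner_integrable_compose2[of "\<lambda>x y. norm (x - y)" lebesgue "s i" "u i"] s u
      by (auto intro!: simple_bochner_integral_eq_nn_integral)
    also have "\<dots> \<le> (\<integral>\<^sup>+t. ennreal (norm (f t - s i t)) + ennreal (norm (f t - u i t)) \<partial>lebesgue)"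
      by (intro nn_integral_mono)
         (metis dual_order.refl norm_diff_triangle_le norm_minus_commute ennreal_leI ennreal_plus norm_ge_zero)
    also have "\<dots> = (\<integral>\<^sup>+t. norm (f t - s i t) \<partial>lebesgue) + (\<integral>\<^sup>+t. norm (f t - u i t) \<partial>lebesgue)"
      using AE_lim_borel_measurable_norm_diff[OF s(1,2)] s(1) u(1)
      by (intro nn_integral_add) auto
    finally show ?thesis .
  qed
  have "(\<lambda>i. ennreal (norm (?S i - ?U i))) \<longlonglongrightarrow> 0"
    by (rule tendsto_sandwich[OF _ _ tendsto_const])
       (use bound tendsto_add[OF s(3) u(2)] in auto)
  moreover have "(\<lambda>i. ennreal (norm (?S i - ?U i))) \<longlonglongrightarrow> ennreal (norm (x - y))"
    by (intro tendsto_intros s u)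
  ultimately have "ennreal (norm (x - y)) = 0"
    using LIMSEQ_unique by blast
  then show ?thesis
    by simp
qed

lemma bochner_integral_on_eqI:
  "has_bochner_integral_banach (\<lambda>t. if t \<in> A then g t else 0) x \<Longrightarrow> bochner_integral_on g A = x"
  unfolding bochner_integral_on_def using has_bochner_integral_banach_unique by blast

text \<open>On separable Banach spaces this is the library's Bochner integral.\<close>

lemma has_bochner_integral_banach_iff_library:
  fixes f :: "real \<Rightarrow> 'a::{banach, second_countable_topology}"
  shows "has_bochner_integral_banach f x \<longleftrightarrow> has_bochner_integral lebesgue f x"
proof
  assume "has_bochner_integral_banach f x"
  then obtain s where s: "\<And>i. Bochner_Integration.simple_bochner_integrable lebesgue (s i)"
      "AE t in lebesgue. (\<lambda>i. s i t) \<longlonglongrightarrow> f t"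
      "(\<lambda>i::nat. \<integral>\<^sup>+t. norm (f t - s i t) \<partial>lebesgue) \<longlonglongrightarrow> 0"
      "(\<lambda>i. Bochner_Integration.simple_bochner_integral lebesgue (s i)) \<longlonglongrightarrow> x"
    by (auto simp: has_bochner_integral_banach_def)
  have [measurable]: "s i \<in> borel_measurable lebesgue" for i
    using s by (auto intro: simple_bochner_integrable_borel_measurable)
  have l: "(\<lambda>t. lim (\<lambda>i. s i t)) \<in> borel_measurable lebesgue"
    by measurable
  have "AE t in lebesgue. f t = lim (\<lambda>i. s i t)"
    using s(2) by eventually_elim (auto intro!: limI[symmetric])
  then have "f \<in> borel_measurable lebesgue"
    by (rule borel_measurable_lebesgue_AE[OF l])
  then show "has_bochner_integral lebesgue f x"
    using s by (intro has_bochner_integral.intros)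
next
  assume f: "has_bochner_integral lebesgue f x"
  then have int: "integrable lebesgue f" and x: "integral\<^sup>L lebesgue f = x"
    by (auto simp: has_bochner_integral_iff)
  have [measurable]: "f \<in> borel_measurable lebesgue"
    using int by simp
  obtain s where s: "\<And>i. simple_function lebesgue (s i)"
      "\<And>t. (\<lambda>i. s i t) \<longlonglongrightarrow> f t" "\<And>i t. norm (s i t) \<le> 2 * norm (f t)"
    using borel_measurable_implies_sequence_metric[of f lebesgue 0] by auto
  have fin: "(\<integral>\<^sup>+t. ennreal (2 * norm (f t)) \<partial>lebesgue) < \<infinity>"
    using integrable_iff_bounded[THEN iffD1, OF integrable_scaleR_right[OF int, of 2]] by auto
  have [measurable]: "s i \<in> borel_measurable lebesgue" for i
    by (rule borel_measurable_simple_function[OF s(1)])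
  have sbi: "Bochner_Integration.simple_bochner_integrable lebesgue (s i)" for i
  proof (rule simple_bochner_integrableI_bounded[OF s(1)])
    have "(\<integral>\<^sup>+t. norm (s i t) \<partial>lebesgue) \<le> (\<integral>\<^sup>+t. ennreal (2 * norm (f t)) \<partial>lebesgue)"
      by (intro nn_integral_mono ennreal_leI s)
    with fin show "(\<integral>\<^sup>+t. norm (s i t) \<partial>lebesgue) < \<infinity>"
      by simp
  qed
  have lim: "(\<lambda>i. \<integral>\<^sup>+t. norm (f t - s i t) \<partial>lebesgue) \<longlonglongrightarrow> 0"
    using s fin by (intro nn_integral_dominated_convergence_norm[where w="\<lambda>t. 2 * norm (f t)"]) auto
  have "(\<lambda>i. Bochner_Integration.simple_bochner_integral lebesgue (s i)) \<longlonglongrightarrow> x"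
  proof -
    have "(\<lambda>i. integral\<^sup>L lebesgue (s i)) \<longlonglongrightarrow> integral\<^sup>L lebesgue f"
      using s int by (intro integral_dominated_convergence[where w="\<lambda>t. 2 * norm (f t)"]) auto
    then show ?thesis
      using x simple_bochner_integrable_eq_integral[OF sbi] by simp
  qed
  with sbi lim s(2) show "has_bochner_integral_banach f x"
    unfolding has_bochner_integral_banach_def by (intro exI[of _ s]) auto
qed

end

(* On a compact interval f is Lipschitz: off a null set its right derivative is bounded, and on the
   null set its growth is absorbed by a small monotone function with infinite right derivative there.
   Hence the difference quotients (f(t + h) - f(t)) / h converge boundedly to the right derivative,
   so g is almost everywhere a bounded limit of them, while their integrals
   are differences of averages of f near the two end points and converge to f(t2) - f(t1) by
   continuity.  To stay strongly measurable in a nonseparable space, the quotients are sampled on a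
   grid of mesh (b - a) / n^2 with step h = (b - a) / n, which makes them simple functions with
   telescoping integral. *)
theory Submission
  imports Defs
begin

section \<open>A mean value inequality for right derivatives\<close>

text \<open>Continuous induction from \<open>a\<close> to \<open>b\<close>: the supremum
  \<open>c\<close> of the points where the bound holds still satisfies it, and \<open>step\<close>
  at \<open>c\<close> would carry it further if \<open>c < b\<close>. Continuity of \<open>f\<close>
  and monotonicity of \<open>\<phi>\<close> together pass the bound to the supremum, even where
  \<open>\<phi>\<close> jumps.\<close>

lemma norm_diff_le_mono_if_eventually_at_right:
  fixes f :: "real \<Rightarrow> 'a::real_normed_vector" and \<phi> :: "real \<Rightarrow> real"
  assumes "a \<le> b" and cont: "continuous_on {a..b} f" and mono: "mono_on {a..b} \<phi>"
    and step: "\<And>t. a \<le> t \<Longrightarrow> t < b \<Longrightarrow> \<forall>\<^sub>F s in at_right t. norm (f s - f t) \<le> \<phi> s - \<phi> t"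
  shows "norm (f b - f a) \<le> \<phi> b - \<phi> a"
proof -
  define S where "S = {t \<in> {a..b}. norm (f t - f a) \<le> \<phi> t - \<phi> a}"
  define c where "c = Sup S"
  have "a \<in> S" "bdd_above S"
    using \<open>a \<le> b\<close> by (auto simp: S_def intro!: bdd_aboveI[of _ b])
  then have c: "a \<le> c" "c \<le> b" and le_c: "t \<le> c" if "t \<in> S" for t
    unfolding c_def using that by (auto intro: cSup_upper cSup_least simp: S_def)
  \<comment> \<open>With the right-hand side frozen at \<open>\<phi> c\<close> the set is closed
    because \<open>f\<close> is continuous, and it contains \<open>S\<close> because
    \<open>\<phi>\<close> is monotone; hence it contains \<open>Sup S\<close>.\<close>
  have "c \<in> {t \<in> {a..b}. norm (f t - f a) \<le> \<phi> c - \<phi> a}"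
    unfolding c_def
  proof (rule closed_subset_contains_Sup[OF _ _ _ \<open>bdd_above S\<close>])
    show "closed {t \<in> {a..b}. norm (f t - f a) \<le> \<phi> (Sup S) - \<phi> a}"
      by (intro continuous_on_closed_Collect_le continuous_intros cont)
    show "S \<subseteq> {t \<in> {a..b}. norm (f t - f a) \<le> \<phi> (Sup S) - \<phi> a}"
    proof
      fix t assume t: "t \<in> S"
      then have "\<phi> t \<le> \<phi> c"
        using c le_c[OF t] by (intro mono_onD[OF mono]) (auto simp: S_def)
      with t show "t \<in> {t \<in> {a..b}. norm (f t - f a) \<le> \<phi> (Sup S) - \<phi> a}"
        by (auto simp: S_def c_def)
    qed
    show "S \<noteq> {}" using \<open>a \<in> S\<close> by auto
  qed
  then have le: "norm (f c - f a) \<le> \<phi> c - \<phi> a" by simp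
  have "c = b"
  proof (rule ccontr)
    assume "c \<noteq> b"
    with c \<open>a \<in> S\<close> have "c < b" by fastforce
    have "\<forall>\<^sub>F s in at_right c. norm (f s - f c) \<le> \<phi> s - \<phi> c \<and> s \<in> {c<..<b}"
      using step[of c] c \<open>a \<in> S\<close> \<open>c < b\<close> 
      by (intro eventually_conj eventually_at_right_real) auto
    then obtain s where s: "norm (f s - f c) \<le> \<phi> s - \<phi> c" "c < s" "s < b"
      using eventually_happens'[OF trivial_limit_at_right_real] by fastforce
    have "norm (f s - f a) \<le> norm (f s - f c) + norm (f c - f a)"
      using norm_triangle_ineq[of "f s - f c" "f c - f a"] by simp
    with s le have "norm (f s - f a) \<le> \<phi> s - \<phi> a" by linarith
    then have "s \<in> S" using s c \<open>a \<in> S\<close> by (force simp: S_def)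
    with le_c s show False by fastforce
  qed
  with le show ?thesis by simp
qed

lemma eventually_at_right_norm_diff_le:
  fixes f :: "real \<Rightarrow> 'a::real_normed_vector"
  assumes "(f has_vector_derivative D) (at_right t)" and "norm D < K"
  shows "\<forall>\<^sub>F s in at_right t. norm (f s - f t) \<le> K * (s - t)"
proof -
  have "\<forall>\<^sub>F h in at_right 0. norm ((1 / h) *\<^sub>R (f (t + h) - f t)) < K"
    using assms by (intro order_tendstoD(2)[OF tendsto_norm])
      (auto simp: has_vector_derivative_at_right_iff)
  moreover have "\<forall>\<^sub>F h::real in at_right 0. 0 < h"
    by (rule eventually_at_right_less)
  ultimately show ?thesis
    unfolding eventually_at_right_to_0[of _ t]
    by eventually_elim (auto simp: divide_simps mult.commute add.commute)
qed

text \<open>The monotone function is the sum of the distribution functions of a sequence of open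
  supersets of \<open>N\<close> with summable measures.\<close>

lemma null_set_infinite_right_derivative:
  fixes N :: "real set"
  assumes N: "N \<in> null_sets lebesgue" and "e > 0"
  obtains \<sigma> :: "real \<Rightarrow> real" where "mono \<sigma>" "\<And>t. 0 \<le> \<sigma> t" "\<And>t. \<sigma> t \<le> e"
    "\<And>t K. t \<in> N \<Longrightarrow> \<forall>\<^sub>F s in at_right t. K * (s - t) \<le> \<sigma> s - \<sigma> t"
proof -
  \<comment> \<open>Positive weights with total \<open>e\<close>: they bound the measures of the
    open covers, which keeps \<open>\<sigma>\<close> below \<open>e\<close>.\<close>
  define w where "w k = e * (1/2) ^ Suc k" for k
  have w: "w sums e"
    using sums_mult[OF power_half_series, of e] by (simp add: w_def[abs_def])
  have "\<exists>U. open U \<and> N \<subseteq> U \<and> U \<in> lmeasurable \<and> measure lebesgue U \<le> w k" for k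
  proof -
    have "w k > 0" using \<open>e > 0\<close> by (simp add: w_def)
    then obtain U where U: "open U" "N \<subseteq> U" "U - N \<in> lmeasurable"
        "emeasure lebesgue (U - N) < ennreal (w k)"
      using sets_lebesgue_outer_open[of N "w k"] N by blast
    \<comment> \<open>Outer regularity only makes \<open>U - N\<close> small, but removing the null
      set \<open>N\<close> does not change the measure.\<close>
    have "emeasure lebesgue U = emeasure lebesgue (U - N)"
      using U(1) by (intro emeasure_Diff_null_set[OF N, symmetric]) auto
    then show ?thesis
      using U \<open>w k > 0\<close>
      by (intro exI[of _ U])
        (auto simp: fmeasurable_def measure_def intro!: enn2real_leI less_imp_le order.strict_trans[OF _ ennreal_less_top])
  qed
  then obtain U where U: "\<And>k. open (U k)" "\<And>k. N \<subseteq> U k" "\<And>k. U k \<in> lmeasurable"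
      "\<And>k. measure lebesgue (U k) \<le> w k"
    by metis
  define m where "m k t = measure lebesgue (U k \<inter> {..t})" for k t
  have Um: "U k \<inter> A \<in> lmeasurable" if "A \<in> sets lebesgue" for k A
    using that U by (intro fmeasurable_Int_fmeasurable) auto
  have m: "0 \<le> m k t" "m k t \<le> w k" for k t
    using U(4)[of k] measure_mono_fmeasurable[of "U k \<inter> {..t}" "U k" lebesgue] U(3)
      Um[THEN fmeasurableD, of "{..t}" k]
    by (auto simp: m_def)
  have m_mono: "m k s \<le> m k t" if "s \<le> t" for k s t
    unfolding m_def using that Um by (intro measure_mono_fmeasurable) (auto intro: fmeasurableD)
  have m_sum: "summable (\<lambda>k. m k t)" for t
    by (rule summable_comparison_test[OF _ sums_summable[OF w]]) (use m in auto)
  define \<sigma> where "\<sigma> t = (\<Sum>k. m k t)" for t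
  show ?thesis
  proof
    show "mono \<sigma>"
      unfolding \<sigma>_def by (intro monoI suminf_le m_sum m_mono)
    show "0 \<le> \<sigma> t" for t
      unfolding \<sigma>_def by (intro suminf_nonneg m_sum m)
    show "\<sigma> t \<le> e" for t
      unfolding \<sigma>_def sums_unique[OF w] by (intro suminf_le m_sum m sums_summable[OF w])
    show "\<forall>\<^sub>F s in at_right t. K * (s - t) \<le> \<sigma> s - \<sigma> t" if "t \<in> N" for t K
    proof -
      \<comment> \<open>For \<open>s\<close> close to \<open>t\<close>, \<open>{t..s}\<close> lies
        in the first \<open>n\<close> covers, so each of these \<open>n\<close> summands rises by at
        least \<open>s - t\<close>, while the others do not fall. Thus the increment of
        \<open>\<sigma>\<close> is at least \<open>n * (s - t)\<close>.\<close>
      obtain n :: nat where n: "K \<le> n" using real_arch_simple by blast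
      have "\<forall>k\<in>{..<n}. \<forall>\<^sub>F s in at_right t. {t..s} \<subseteq> U k"
      proof
        fix k
        obtain d where d: "d > 0" "ball t d \<subseteq> U k"
          using U \<open>t \<in> N\<close> open_contains_ball by blast
        have "\<forall>\<^sub>F s in at_right t. s \<in> {t<..<t + d}"
          using d by (intro eventually_at_right_real) auto
        then show "\<forall>\<^sub>F s in at_right t. {t..s} \<subseteq> U k"
          by eventually_elim (use d in \<open>force simp: dist_real_def\<close>)
      qed
      then have "\<forall>\<^sub>F s in at_right t. \<forall>k\<in>{..<n}. {t..s} \<subseteq> U k"
        by (intro eventually_ball_finite) auto
      then show ?thesis
        using eventually_at_right_less[of t]
      proof eventually_elim
        case (elim s)
        have "s - t \<le> m k s - m k t" if "k < n" for k
        proof -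
          have "measure lebesgue {t<..s} + m k t = measure lebesgue ({t<..s} \<union> (U k \<inter> {..t}))"
            unfolding m_def using fmeasurableD2[OF Um[of "{..t}" k]] fmeasurableD[OF Um[of "{..t}" k]]
            by (intro measure_Union[symmetric]) (use elim in \<open>simp_all add: disjoint_iff\<close>)
          also have "\<dots> \<le> m k s"
          proof -
            have "{t..s} \<subseteq> U k" using elim that by simp
            then have "{t<..s} \<union> (U k \<inter> {..t}) \<subseteq> U k \<inter> {..s}"
              using elim by force
            then show ?thesis
              unfolding m_def using fmeasurableD[OF Um[of "{..t}" k]] Um[of "{..s}" k]
              by (intro measure_mono_fmeasurable) auto
          qed
          finally show ?thesis using elim by simp
        qed
        then have "n * (s - t) \<le> (\<Sum>k<n. m k s - m k t)"
          using sum_mono[of "{..<n}" "\<lambda>_. s - t" "\<lambda>k. m k s - m k t"] by simp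
        also have "\<dots> \<le> (\<Sum>k. m k s - m k t)"
          using elim m_mono[of t s] by (intro sum_le_suminf summable_diff m_sum) auto
        also have "\<dots> = \<sigma> s - \<sigma> t"
          unfolding \<sigma>_def by (intro suminf_diff[symmetric] m_sum)
        finally show ?case
          using mult_right_mono[OF n, of "s - t"] elim by linarith
      qed
    qed
  qed
qed

text \<open>The comparison function is \<open>(M + e) * t + \<sigma> t\<close>. Off \<open>N\<close>
  its linear part strictly beats the bound on the derivative; on \<open>N\<close>, where only
  existence of the derivative is known, \<open>\<sigma>\<close> beats it. Neither part decreases, so
  either one suffices.\<close>

lemma right_derivative_AE_bounded_imp_norm_diff_le:
  fixes f f' :: "real \<Rightarrow> 'a::real_normed_vector"
  assumes "a \<le> b" and cont: "continuous_on {a..b} f"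
    and deriv: "\<And>t. a \<le> t \<Longrightarrow> t < b \<Longrightarrow> (f has_vector_derivative f' t) (at_right t)"
    and N: "N \<in> null_sets lebesgue"
    and bound: "\<And>t. a \<le> t \<Longrightarrow> t < b \<Longrightarrow> t \<notin> N \<Longrightarrow> norm (f' t) \<le> M" and "0 \<le> M"
  shows "norm (f b - f a) \<le> M * (b - a)"
proof (rule field_le_epsilon)
  fix \<epsilon> :: real assume "\<epsilon> > 0"
  \<comment> \<open>The surplus slope costs \<open>e * (b - a)\<close> and the rise of
    \<open>\<sigma>\<close> at most \<open>e\<close>, together \<open>\<epsilon>\<close>.\<close>
  define e where "e = \<epsilon> / (b - a + 1)"
  have e: "e > 0" "e * (b - a + 1) = \<epsilon>"
    using \<open>\<epsilon> > 0\<close> \<open>a \<le> b\<close> by (auto simp: e_def)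
  obtain \<sigma> :: "real \<Rightarrow> real" where \<sigma>: "mono \<sigma>" "\<And>t. 0 \<le> \<sigma> t" "\<And>t. \<sigma> t \<le> e"
      "\<And>t K. t \<in> N \<Longrightarrow> \<forall>\<^sub>F s in at_right t. K * (s - t) \<le> \<sigma> s - \<sigma> t"
    using null_set_infinite_right_derivative[OF N \<open>e > 0\<close>] by metis
  let ?\<phi> = "\<lambda>t. (M + e) * t + \<sigma> t"
  have "norm (f b - f a) \<le> ?\<phi> b - ?\<phi> a"
  proof (rule norm_diff_le_mono_if_eventually_at_right[OF \<open>a \<le> b\<close> cont])
    show "mono_on {a..b} ?\<phi>"
      using \<open>0 \<le> M\<close> e \<sigma> by (auto intro!: mono_onI add_mono mult_left_mono dest: monoD)
    show "\<forall>\<^sub>F s in at_right t. norm (f s - f t) \<le> ?\<phi> s - ?\<phi> t" if t: "a \<le> t" "t < b" for t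
    proof (cases "t \<in> N")
      case True
      \<comment> \<open>The slope to beat may vary with \<open>t\<close>, since at a point of
        \<open>N\<close> the function \<open>\<sigma>\<close> outgrows every
        \<open>K\<close>.\<close>
      have "norm (f' t) < norm (f' t) + 1" by simp
      from eventually_at_right_norm_diff_le[OF deriv[OF t] this] \<sigma>(4)[OF True, of "norm (f' t) + 1"]
        eventually_at_right_less[of t]
      show ?thesis
      proof eventually_elim
        case (elim s)
        have "0 \<le> (M + e) * (s - t)" using elim e \<open>0 \<le> M\<close> by simp
        with elim show ?case by (simp add: algebra_simps)
      qed
    next
      case False
      then have "norm (f' t) < M + e" using bound[OF t] e by fastforce
      from eventually_at_right_norm_diff_le[OF deriv[OF t] this] eventually_at_right_less[of t]
      show ?thesis
      proof eventually_elim
        case (elim s)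
        then show ?case using monoD[OF \<sigma>(1), of t s] by (simp add: algebra_simps)
      qed
    qed
  qed
  also have "\<dots> \<le> M * (b - a) + \<epsilon>"
    using \<sigma>(2)[of a] \<sigma>(3)[of b] e(2) by (simp add: algebra_simps)
  finally show "norm (f b - f a) \<le> M * (b - a) + \<epsilon>" .
qed

section \<open>Telescoping sums and integrals of simple functions\<close>

text \<open>If \<open>X r\<close> is the sum of the first \<open>r\<close> terms, both sides equal
  \<open>X (m + k) - X m - X k\<close>. This trades many increments over a short shift for few
  increments over a long one.\<close>

lemma sum_shift_diff_commute:
  fixes x :: "nat \<Rightarrow> 'a::ab_group_add"
  shows "(\<Sum>i<m. x (i + k) - x i) = (\<Sum>j<k. x (j + m) - x j)"
proof (induction m)
  case (Suc m)
  have "(\<Sum>j<k. x (j + Suc m) - x j) =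
      (\<Sum>j<k. x (j + m) - x j) + (\<Sum>j<k. x (Suc j + m) - x (j + m))"
    unfolding sum.distrib[symmetric] by (rule sum.cong) auto
  also have "(\<Sum>j<k. x (Suc j + m) - x (j + m)) = x (k + m) - x (0 + m)"
    by (rule sum_lessThan_telescope)
  finally show ?case
    by (simp only: Suc sum.lessThan_Suc add_0 add.commute[of k m])
qed simp

lemma simple_bochner_integral_indicator:
  fixes c :: "'a::real_normed_vector"
  assumes A: "A \<in> fmeasurable M"
  shows "Bochner_Integration.simple_bochner_integrable M (\<lambda>t. indicator A t *\<^sub>R c)"
    and "Bochner_Integration.simple_bochner_integral M (\<lambda>t. indicator A t *\<^sub>R c) = measure M A *\<^sub>R c"
proof -
  have 1: "Bochner_Integration.simple_bochner_integrable M (indicator A :: _ \<Rightarrow> real)"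
  proof
    show "simple_function M (indicator A :: _ \<Rightarrow> real)" using A by auto
    have "{y \<in> space M. indicator A y \<noteq> (0::real)} = A"
      using A by (auto simp: indicator_def dest: fmeasurableD sets.sets_into_space)
    then show "emeasure M {y \<in> space M. indicator A y \<noteq> (0::real)} \<noteq> \<infinity>"
      using fmeasurableD2[OF A] by simp
  qed
  show "Bochner_Integration.simple_bochner_integrable M (\<lambda>t. indicator A t *\<^sub>R c)"
    by (rule simple_bochner_integrable_compose2[where p="\<lambda>x y. x *\<^sub>R c", OF _ 1 1]) simp
  have "Bochner_Integration.simple_bochner_integral M (indicator A :: _ \<Rightarrow> real) = measure M A"
    using simple_bochner_integrable_eq_integral[OF 1] A
    by (simp add: fmeasurable_def has_bochner_integral_integral_eq[OF has_bochner_integral_indicator]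
        Int_absorb2 sets.sets_into_space)
  then show "Bochner_Integration.simple_bochner_integral M (\<lambda>t. indicator A t *\<^sub>R c) = measure M A *\<^sub>R c"
    using simple_bochner_integral_linear[OF _ 1, of "\<lambda>x. x *\<^sub>R c"]
    by (simp add: linear_scaleR_left)
qed

lemma simple_bochner_integral_sum:
  fixes s :: "'i \<Rightarrow> 'b \<Rightarrow> 'a::real_normed_vector"
  assumes "finite I" "\<And>i. i \<in> I \<Longrightarrow> Bochner_Integration.simple_bochner_integrable M (s i)"
  shows "Bochner_Integration.simple_bochner_integrable M (\<lambda>t. \<Sum>i\<in>I. s i t) \<and>
    Bochner_Integration.simple_bochner_integral M (\<lambda>t. \<Sum>i\<in>I. s i t) =
      (\<Sum>i\<in>I. Bochner_Integration.simple_bochner_integral M (s i))"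
  using assms
proof (induction I)
  case empty
  \<comment> \<open>The zero function is written as a multiple of the indicator of the empty set, so
    that the indicator lemma gives its integral.\<close>
  have "Bochner_Integration.simple_bochner_integrable M (\<lambda>t. indicator {} t *\<^sub>R (0::'a))"
    "Bochner_Integration.simple_bochner_integral M (\<lambda>t. indicator {} t *\<^sub>R (0::'a)) = 0"
    using simple_bochner_integral_indicator[of "{}" M "0::'a"] by auto
  then show ?case by simp
next
  case (insert i I)
  then show ?case
    by (auto intro: simple_bochner_integrable_compose2[where p="(+)"] simp: simple_bochner_integral_add)
qed

section \<open>Integrating the right derivative of a Lipschitz function\<close>

text \<open>\<open>F\<close> lives on the whole line because quotients sampled near \<open>b\<close>
  reach beyond \<open>b\<close>. The constant \<open>M\<close> does three jobs: it bounds the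
  sampled quotients, the error of sampling, and the deviation of the end averages from
  \<open>F b\<close> and \<open>F a\<close>.\<close>

lemma lipschitz_right_derivative_has_bochner_integral:
  fixes F g :: "real \<Rightarrow> 'a::real_normed_vector"
  assumes "a < b" and lip: "M-lipschitz_on UNIV F"
    and deriv: "AE t in lebesgue. t \<in> {a..<b} \<longrightarrow> (F has_vector_derivative g t) (at_right t)"
  shows "has_bochner_integral_banach (\<lambda>t. if t \<in> {a..b} then g t else 0) (F b - F a)"
proof -
  define L where "L = b - a"
  have L: "L > 0" using \<open>a < b\<close> by (simp add: L_def)
  have M: "0 \<le> M" and lipM: "norm (F x - F y) \<le> M * \<bar>x - y\<bar>" for x y
    using lip by (auto simp: lipschitz_on_def dist_norm)
  \<comment> \<open>One step of the quotients spans \<open>Suc n\<close> grid cells. Moving both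
    ends of a quotient by at most one mesh changes it by at most \<open>2 * M / Suc n\<close>, which
    tends to zero only because the mesh is of smaller order than the step.\<close>
  define p where "p n i = a + real i * L / (real (Suc n))\<^sup>2" for n i
  define c where "c n i = (Suc n / L) *\<^sub>R (F (p n (i + Suc n)) - F (p n i))" for n i
  define s where "s n t = (\<Sum>i<(Suc n)\<^sup>2. indicator {p n i..<p n (Suc i)} t *\<^sub>R c n i)" for n t
  let ?g = "\<lambda>t. if t \<in> {a..b} then g t else 0"
  have p_le: "p n i \<le> p n j \<longleftrightarrow> i \<le> j" and p_less: "p n i < p n j \<longleftrightarrow> i < j" for n i j
    using L by (auto simp: p_def divide_le_cancel divide_less_cancel)
  have p_0: "p n 0 = a" and p_end: "p n ((Suc n)\<^sup>2) = b" for n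
    by (simp_all add: p_def L_def del: of_nat_Suc)
  have p_Suc: "p n (Suc i) = p n i + L / (real (Suc n))\<^sup>2" for n i
    by (simp add: p_def add_divide_distrib algebra_simps)
  have p_add: "p n (i + Suc n) = p n i + L / Suc n" for n i
    unfolding p_def of_nat_add by (simp add: add_divide_distrib algebra_simps power2_eq_square del: of_nat_Suc)
  have c_bound: "norm (c n i) \<le> M" for n i
  proof -
    have "norm (c n i) \<le> (Suc n / L) * (M * (L / Suc n))"
      unfolding c_def p_add norm_scaleR using L lipM[of "p n i + L / Suc n" "p n i"]
      by (intro mult_mono) auto
    also have "\<dots> = M" using L by (simp del: of_nat_Suc)
    finally show ?thesis .
  qed
  have s_inside: "\<exists>k. p n k \<le> t \<and> t < p n (Suc k) \<and> s n t = c n k" if t: "a \<le> t" "t < b" for n t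
  proof -
    \<comment> \<open>The number of whole meshes between \<open>a\<close> and \<open>t\<close>.
      Cells are half-open, so exactly one contains \<open>t\<close>; \<open>t < b\<close> makes it
      one of those summed in \<open>s n\<close>.\<close>
    define k where "k = nat \<lfloor>(t - a) * (Suc n)\<^sup>2 / L\<rfloor>"
    have "0 \<le> (t - a) * (Suc n)\<^sup>2 / L" using t L by simp
    then have "real k \<le> (t - a) * (Suc n)\<^sup>2 / L" "(t - a) * (Suc n)\<^sup>2 / L < real (Suc k)"
      unfolding k_def by linarith+
    then have k: "p n k \<le> t" "t < p n (Suc k)"
      using L unfolding p_def
      by (simp_all add: field_simps del: of_nat_Suc)
    then have "k < (Suc n)\<^sup>2"
      using t p_end[of n] p_less[of n k "(Suc n)\<^sup>2"] by linarith
    have "indicator {p n i..<p n (Suc i)} t *\<^sub>R c n i = (if i = k then c n i else 0)" for i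
    proof (cases "i = k")
      case False
      then have "i < k \<or> k < i" by linarith
      then have "Suc i \<le> k \<or> Suc k \<le> i" by linarith
      then have "t \<notin> {p n i..<p n (Suc i)}"
        using k p_le[of n "Suc i" k] p_le[of n "Suc k" i] by auto
      then show ?thesis using False by simp
    qed (use k in simp)
    then have "s n t = c n k"
      using \<open>k < (Suc n)\<^sup>2\<close> by (simp add: s_def sum.delta)
    with k show ?thesis by blast
  qed
  have s_outside: "s n t = 0" if "t < a \<or> b \<le> t" for n t
  proof -
    have "t \<notin> {p n i..<p n (Suc i)}" if "i < (Suc n)\<^sup>2" for i
      using \<open>t < a \<or> b \<le> t\<close> p_le[of n 0 i] p_le[of n "Suc i" "(Suc n)\<^sup>2"] that
      unfolding p_0 p_end by auto
    then show ?thesis by (auto simp: s_def intro!: sum.neutral)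
  qed
  have "Bochner_Integration.simple_bochner_integrable lebesgue (s n) \<and>
      Bochner_Integration.simple_bochner_integral lebesgue (s n) =
      (\<Sum>i<(Suc n)\<^sup>2. (L / (real (Suc n))\<^sup>2) *\<^sub>R c n i)" for n
  proof -
    let ?s = "\<lambda>i t. indicator {p n i..<p n (Suc i)} t *\<^sub>R c n i"
    have s: "Bochner_Integration.simple_bochner_integrable lebesgue (?s i)"
      "Bochner_Integration.simple_bochner_integral lebesgue (?s i) = (L / (real (Suc n))\<^sup>2) *\<^sub>R c n i" for i
      using simple_bochner_integral_indicator[of "{p n i..<p n (Suc i)}" lebesgue "c n i"] L
        fmeasurableI[of "{p n i..<p n (Suc i)}" lebesgue]
      by (simp_all add: p_Suc ennreal_less_top del: of_nat_Suc)
    show ?thesis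
      unfolding s_def[abs_def] s(2)[symmetric]
      by (rule simple_bochner_integral_sum) (simp, rule s)
  qed
  then have s_int: "Bochner_Integration.simple_bochner_integrable lebesgue (s n)"
    and s_val: "Bochner_Integration.simple_bochner_integral lebesgue (s n) =
      (\<Sum>i<(Suc n)\<^sup>2. (L / (real (Suc n))\<^sup>2) *\<^sub>R c n i)" for n
    by blast+
  have pointwise: "(\<lambda>n. s n t) \<longlonglongrightarrow> g t"
    if t: "a \<le> t" "t < b" and D: "(F has_vector_derivative g t) (at_right t)" for t
  proof -
    define h where "h n = L / Suc n" for n
    have h: "h \<longlonglongrightarrow> 0"
      unfolding h_def by (intro LIMSEQ_Suc lim_const_over_n)
    have "filterlim h (at_right 0) sequentially"
      using h L by (intro filterlim_atI eventuallyI tendsto_imp_filterlim_at_right) (auto simp: h_def)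
    then have "(\<lambda>n. (1 / h n) *\<^sub>R (F (t + h n) - F t)) \<longlonglongrightarrow> g t"
      using D unfolding has_vector_derivative_at_right_iff by (rule filterlim_compose[rotated])
    \<comment> \<open>The true quotients at \<open>t\<close> converge by the right derivative; it
      remains to compare them with the samples taken at the left end of the cell.\<close>
    moreover have "(\<lambda>n. s n t - (1 / h n) *\<^sub>R (F (t + h n) - F t)) \<longlonglongrightarrow> 0"
    proof (rule Lim_null_comparison)
      show "\<forall>\<^sub>F n in sequentially. norm (s n t - (1 / h n) *\<^sub>R (F (t + h n) - F t)) \<le> 2 * M / Suc n"
      proof (intro always_eventually allI)
        fix n
        obtain k where k: "p n k \<le> t" "t < p n (Suc k)" "s n t = c n k"
          using s_inside[OF t] by blast
        let ?d = "L / (real (Suc n))\<^sup>2"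
        have d: "\<bar>p n k - t\<bar> \<le> ?d" using k p_Suc[of n k] by simp
        have "s n t - (1 / h n) *\<^sub>R (F (t + h n) - F t) =
            (Suc n / L) *\<^sub>R ((F (p n k + h n) - F (t + h n)) - (F (p n k) - F t))"
          unfolding k(3) c_def p_add by (simp add: h_def scaleR_diff_right[symmetric] del: of_nat_Suc)
        also have "norm \<dots> \<le> (Suc n / L) * (M * ?d + M * ?d)"
        proof -
          have "norm (F x - F y) \<le> M * ?d" if "\<bar>x - y\<bar> \<le> ?d" for x y
            using order.trans[OF lipM mult_left_mono[OF that M]] .
          then have "norm ((F (p n k + h n) - F (t + h n)) - (F (p n k) - F t)) \<le> M * ?d + M * ?d"
            using d by (intro order.trans[OF norm_triangle_ineq4 add_mono]) auto
          then show ?thesis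
            using L unfolding norm_scaleR by (intro mult_mono) auto
        qed
        also have "\<dots> = 2 * M / Suc n"
          using L by (simp add: power2_eq_square del: of_nat_Suc)
        finally show "norm (s n t - (1 / h n) *\<^sub>R (F (t + h n) - F t)) \<le> 2 * M / Suc n" .
      qed
      show "(\<lambda>n. 2 * M / real (Suc n)) \<longlonglongrightarrow> 0"
        by (intro LIMSEQ_Suc lim_const_over_n)
    qed
    ultimately show ?thesis
      by (auto dest: tendsto_add)
  qed
  \<comment> \<open>At \<open>b\<close> every \<open>s n\<close> vanishes while
    \<open>?g b = g b\<close>, so this point is discarded.\<close>
  have "AE t in lebesgue. t \<noteq> b"
    by (rule AE_I'[of "{b}"]) (auto simp flip: negligible_iff_null_sets)
  with deriv have lim: "AE t in lebesgue. (\<lambda>n. s n t) \<longlonglongrightarrow> ?g t"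
  proof eventually_elim
    case (elim t)
    show ?case
    proof (cases "a \<le> t \<and> t < b")
      case True
      with elim pointwise[of t] show ?thesis by auto
    next
      case False
      with elim have "?g t = 0" "t < a \<or> b \<le> t" by auto
      then show ?thesis using s_outside[of t] by simp
    qed
  qed
  have s_bound: "norm (s n t) \<le> M * indicator {a..b} t" for n t
  proof (cases "a \<le> t \<and> t < b")
    case True
    then obtain k where "s n t = c n k" using s_inside[of t n] by metis
    then show ?thesis using c_bound[of n k] True by simp
  next
    case False
    then have "s n t = 0" by (intro s_outside) linarith
    then show ?thesis using M by simp
  qed
  \<comment> \<open>Dominated convergence is applied to the real-valued norms only, since values may
    lie in a nonseparable space. The bound \<open>M\<close> on the \<open>s n\<close> passes to
    their limit \<open>?g\<close>, whence the majorant \<open>2 * M\<close> on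
    \<open>{a..b}\<close>.\<close>
  have "(\<lambda>n. \<integral>\<^sup>+t. ennreal (norm (?g t - s n t)) \<partial>lebesgue) \<longlonglongrightarrow> (\<integral>\<^sup>+t. 0 \<partial>(lebesgue :: real measure))"
  proof (rule nn_integral_dominated_convergence[where w="\<lambda>t. ennreal (2 * M) * indicator {a..b} t"])
    show "(\<lambda>t. ennreal (norm (?g t - s n t))) \<in> borel_measurable lebesgue" for n
      using AE_lim_borel_measurable_norm_diff[OF s_int lim s_int] by simp
    show "AE t in lebesgue. ennreal (norm (?g t - s n t)) \<le> ennreal (2 * M) * indicator {a..b} t" for n
      using lim
    proof eventually_elim
      case (elim t)
      have "norm (?g t) \<le> M * indicator {a..b} t"
        using s_bound by (intro Lim_bounded[OF tendsto_norm[OF elim], of 0]) auto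
      with s_bound[of n t] have "norm (?g t - s n t) \<le> 2 * M * indicator {a..b} t"
        using norm_triangle_ineq4[of "?g t" "s n t"] by linarith
      then show ?case
        by (cases "t \<in> {a..b}") (auto intro: ennreal_leI)
    qed
    show "(\<integral>\<^sup>+t. ennreal (2 * M) * indicator {a..b} t \<partial>lebesgue) < \<infinity>"
      using \<open>a < b\<close> by (subst nn_integral_cmult_indicator) (auto simp: ennreal_mult_less_top)
    show "AE t in lebesgue. (\<lambda>n. ennreal (norm (?g t - s n t))) \<longlonglongrightarrow> 0"
      using lim
    proof eventually_elim
      case (elim t)
      have "(\<lambda>n. ennreal (norm (?g t - s n t))) \<longlonglongrightarrow> ennreal (norm (?g t - ?g t))"
        by (rule tendsto_ennrealI[OF tendsto_norm[OF tendsto_diff[OF tendsto_const elim]]])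
      then show ?case by simp
    qed
    show "(\<lambda>t. ennreal (2 * M) * indicator {a..b} t) \<in> borel_measurable lebesgue"
      by (intro borel_measurable_times_ennreal borel_measurable_indicator) auto
  qed simp_all
  moreover have "(\<lambda>n. Bochner_Integration.simple_bochner_integral lebesgue (s n)) \<longlonglongrightarrow> F b - F a"
  proof -
    have diff_diff_swap: "x - y - (z - w) = (x - z) - (y - w)" for x y z w :: 'a
      by (simp add: algebra_simps)
    \<comment> \<open>Mesh divided by step is \<open>1 / Suc n\<close>. Exchanging the two shifts
      leaves an average of \<open>Suc n\<close> increments of \<open>F\<close>, each over the full
      length \<open>L\<close>.\<close>
    have eq: "Bochner_Integration.simple_bochner_integral lebesgue (s n) =
        (1 / Suc n) *\<^sub>R (\<Sum>j<Suc n. F (p n (j + (Suc n)\<^sup>2)) - F (p n j))" for n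
    proof -
      have "L / (real (Suc n))\<^sup>2 * (Suc n / L) = 1 / Suc n"
        using L by (simp add: power2_eq_square del: of_nat_Suc)
      then show ?thesis
        unfolding s_val c_def scaleR_scaleR scaleR_sum_right[symmetric]
          sum_shift_diff_commute[of "\<lambda>i. F (p n i)" "(Suc n)\<^sup>2" "Suc n"]
        by simp
    qed
    have "(\<lambda>n. Bochner_Integration.simple_bochner_integral lebesgue (s n) - (F b - F a)) \<longlonglongrightarrow> 0"
    proof (rule Lim_null_comparison)
      show "\<forall>\<^sub>F n in sequentially. norm (Bochner_Integration.simple_bochner_integral lebesgue (s n) - (F b - F a))
          \<le> 2 * M * L / Suc n"
      proof (intro always_eventually allI)
        fix n
        let ?r = "\<lambda>j. (F (p n (j + (Suc n)\<^sup>2)) - F b) - (F (p n j) - F a)"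
        have avg: "F b - F a = (1 / Suc n) *\<^sub>R (\<Sum>j<Suc n. F b - F a)"
          by (simp add: sum_constant_scaleR del: sum.lessThan_Suc of_nat_Suc)
        have "Bochner_Integration.simple_bochner_integral lebesgue (s n) - (F b - F a) =
            (1 / Suc n) *\<^sub>R (\<Sum>j<Suc n. F (p n (j + (Suc n)\<^sup>2)) - F (p n j)) - (1 / Suc n) *\<^sub>R (\<Sum>j<Suc n. F b - F a)"
          by (rule arg_cong2[where f="(-)", OF eq avg])
        also have "\<dots> = (1 / Suc n) *\<^sub>R (\<Sum>j<Suc n. ?r j)"
          unfolding scaleR_diff_right[symmetric] sum_subtractf[symmetric]
          by (intro arg_cong2[where f=scaleR] sum.cong) (simp_all only: diff_diff_swap)
        finally have "norm (Bochner_Integration.simple_bochner_integral lebesgue (s n) - (F b - F a)) =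
            (1 / Suc n) * norm (\<Sum>j<Suc n. ?r j)"
          by (simp del: sum.lessThan_Suc of_nat_Suc)
        also have "\<dots> \<le> (1 / Suc n) * (\<Sum>j<Suc n. 2 * (M * (L / Suc n)))"
        proof (intro mult_left_mono sum_norm_le)
          fix j assume j: "j \<in> {..<Suc n}"
          \<comment> \<open>A shift by \<open>(Suc n)\<^sup>2\<close> cells is a translation by
            \<open>L\<close>, so both ends of an increment overshoot \<open>b\<close> and
            \<open>a\<close> by the same amount, at most one step.\<close>
          have "p n (j + (Suc n)\<^sup>2) - b = p n j - a"
            using p_end[of n] unfolding p_def of_nat_add add_divide_distrib distrib_right by simp
          moreover have "\<bar>p n j - a\<bar> \<le> L / Suc n"
            using p_add[of n 0] p_le[of n 0 j] p_le[of n j "Suc n"] j unfolding p_0 by auto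
          ultimately have "norm (F (p n (j + (Suc n)\<^sup>2)) - F b) \<le> M * (L / Suc n)"
              "norm (F (p n j) - F a) \<le> M * (L / Suc n)"
            using M by (auto intro!: order.trans[OF lipM mult_left_mono] simp del: of_nat_Suc times_divide_eq_right)
          then have "norm (?r j) \<le> M * (L / Suc n) + M * (L / Suc n)"
            by (intro order.trans[OF norm_triangle_ineq4 add_mono])
          then show "norm (?r j) \<le> 2 * (M * (L / Suc n))"
            by (simp only: mult_2)
        qed simp
        also have "\<dots> = 2 * M * L / Suc n"
          by (simp del: sum.lessThan_Suc of_nat_Suc)
        finally show "norm (Bochner_Integration.simple_bochner_integral lebesgue (s n) - (F b - F a))
            \<le> 2 * M * L / Suc n" .
      qed
      show "(\<lambda>n. 2 * M * L / real (Suc n)) \<longlonglongrightarrow> 0"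
        by (intro LIMSEQ_Suc lim_const_over_n)
    qed
    then show ?thesis by (rule Lim_null[THEN iffD2])
  qed
  ultimately show ?thesis
    unfolding has_bochner_integral_banach_def using s_int lim by (intro exI[of _ s]) auto
qed

section \<open>From local boundedness to the Lipschitz case\<close>

text \<open>Covers equal end points, which the grid construction with \<open>a < b\<close> leaves
  out. The integrand vanishes almost everywhere, so zero simple functions approximate it.\<close>

lemma has_bochner_integral_banach_singleton:
  "has_bochner_integral_banach (\<lambda>t. if t \<in> {a..a} then g t else 0) 0"
proof -
  have s: "Bochner_Integration.simple_bochner_integrable lebesgue (\<lambda>_::real. 0::'a)"
    "Bochner_Integration.simple_bochner_integral lebesgue (\<lambda>_::real. 0::'a) = 0"
    using simple_bochner_integral_sum[of "{}" lebesgue] by auto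
  have "{a} \<in> null_sets lebesgue" by (simp flip: negligible_iff_null_sets)
  then have ae: "AE t in lebesgue. t \<noteq> a" by (rule AE_I') auto
  then have "AE t in lebesgue. ennreal (norm ((if t \<in> {a..a} then g t else 0) - 0)) = 0"
    by eventually_elim auto
  then have "(\<integral>\<^sup>+t. norm ((if t \<in> {a..a} then g t else 0) - 0) \<partial>lebesgue) = (\<integral>\<^sup>+t. 0 \<partial>(lebesgue :: real measure))"
    by (rule nn_integral_cong_AE)
  moreover from ae have "AE t in lebesgue. (\<lambda>i. 0) \<longlonglongrightarrow> (if t \<in> {a..a} then g t else 0)"
    by eventually_elim auto
  ultimately show ?thesis
    unfolding has_bochner_integral_banach_def using s
    by (intro exI[of _ "\<lambda>_ _. 0"]) auto
qed

text \<open>Finitely many of the given neighborhoods cover \<open>K\<close>, and a finite union of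
  bounded sets is bounded.\<close>

lemma locally_bounded_off_compact:
  assumes "locally_bounded_off g J T" and "compact K" "K \<subseteq> J"
  shows "bounded (g ` (K - T))"
proof -
  obtain U where U: "open (U t)" "t \<in> U t" "bounded (g ` (U t - T))" if "t \<in> J" for t
    using assms(1) unfolding locally_bounded_off_def by metis
  have "open (U t)" if "t \<in> K" for t
    using U(1) \<open>K \<subseteq> J\<close> that by blast
  moreover have "K \<subseteq> (\<Union>t\<in>K. U t)"
    using U(2) \<open>K \<subseteq> J\<close> by blast
  ultimately obtain C where C: "C \<subseteq> K" "finite C" "K \<subseteq> (\<Union>t\<in>C. U t)"
    by (rule compactE_image[OF \<open>compact K\<close>])
  have "bounded (\<Union>t\<in>C. g ` (U t - T))"
    using C(1,2) U(3) \<open>K \<subseteq> J\<close> by (intro bounded_UN) auto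
  then show ?thesis
    by (rule bounded_subset) (use C(3) in blast)
qed

lemma right_antiderivative_on_has_bochner_integral:
  fixes f g :: "real \<Rightarrow> 'a::real_normed_vector"
  assumes f: "right_antiderivative_on f g J" and T: "T \<in> null_sets lebesgue"
    and g: "locally_bounded_off g J T" and ab: "a \<le> b" "{a..b} \<subseteq> J"
  shows "has_bochner_integral_banach (\<lambda>t. if t \<in> {a..b} then g t else 0) (f b - f a)"
proof (cases "a = b")
  case True
  then show ?thesis using has_bochner_integral_banach_singleton[of a g] by simp
next
  case False
  with ab have "a < b" by simp
  obtain f' T\<^sub>0 where cont: "continuous_on J f"
      and f': "\<And>t. t \<in> J \<Longrightarrow> (f has_vector_derivative f' t) (at_right t)"
      and T0: "T\<^sub>0 \<in> null_sets lebesgue" "\<And>t. t \<in> J - T\<^sub>0 \<Longrightarrow> f' t = g t"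
    using f unfolding right_antiderivative_on_def by blast
  \<comment> \<open>Off this set the right derivative equals \<open>g\<close> and inherits its bound
    \<open>M\<close> on \<open>{a..b}\<close>.\<close>
  have N: "T \<union> T\<^sub>0 \<in> null_sets lebesgue" using T T0 by auto
  have "bounded (g ` ({a..b} - T))"
    using locally_bounded_off_compact[OF g] ab by auto
  then obtain M where M: "M > 0" "\<And>t. t \<in> {a..b} - T \<Longrightarrow> norm (g t) \<le> M"
    unfolding bounded_pos by auto
  have lip: "norm (f y - f x) \<le> M * (y - x)" if "a \<le> x" "x \<le> y" "y \<le> b" for x y
  proof (rule right_derivative_AE_bounded_imp_norm_diff_le[OF \<open>x \<le> y\<close> _ _ N])
    show "continuous_on {x..y} f"
      by (rule continuous_on_subset[OF cont]) (use that ab in auto)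
    show "(f has_vector_derivative f' t) (at_right t)" if "x \<le> t" "t < y" for t
      by (rule f') (use that \<open>a \<le> x\<close> \<open>y \<le> b\<close> ab in auto)
    show "norm (f' t) \<le> M" if "x \<le> t" "t < y" "t \<notin> T \<union> T\<^sub>0" for t
    proof -
      have "t \<in> {a..b}" using that \<open>a \<le> x\<close> \<open>y \<le> b\<close> by auto
      with T0(2)[of t] M(2)[of t] that ab show ?thesis by auto
    qed
  qed (use M in auto)
  \<comment> \<open>Outside \<open>{a..b}\<close> the function is frozen at its end values. Clamping
    does not increase distances, so \<open>M\<close> remains a Lipschitz constant on the whole
    line.\<close>
  define F where "F t = f (max a (min b t))" for t
  have lipF: "M-lipschitz_on UNIV F"
  proof (rule lipschitz_onI)
    have le: "norm (F y - F x) \<le> M * (y - x)" if "x \<le> y" for x y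
    proof -
      have "norm (F y - F x) \<le> M * (max a (min b y) - max a (min b x))"
        unfolding F_def using that ab by (intro lip) auto
      also have "\<dots> \<le> M * (y - x)"
        using that M by (intro mult_left_mono) auto
      finally show ?thesis .
    qed
    show "dist (F x) (F y) \<le> M * dist x y" for x y
      using le[of x y] le[of y x] by (cases "x \<le> y") (auto simp: dist_norm norm_minus_commute)
  qed (use M in auto)
  have "AE t in lebesgue. t \<notin> T\<^sub>0" using T0(1) by (rule AE_not_in)
  then have "AE t in lebesgue. t \<in> {a..<b} \<longrightarrow> (F has_vector_derivative g t) (at_right t)"
  proof eventually_elim
    case (elim t)
    show ?case
    proof
      assume t: "t \<in> {a..<b}"
      have eq: "F s = f s" if "s \<in> {a..b}" for s using that by (auto simp: F_def)
      have "t \<in> J" using t ab by auto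
      then have "(f has_vector_derivative g t) (at_right t)" using f' T0 elim by fastforce
      \<comment> \<open>As \<open>t < b\<close>, all increments \<open>h\<close> in
        \<open>{0<..<b - t}\<close> stay in \<open>{a..b}\<close>, where \<open>F\<close> and
        \<open>f\<close> agree.\<close>
      then show "(F has_vector_derivative g t) (at_right t)"
        unfolding has_vector_derivative_at_right_iff
        by (rule Lim_transform_eventually)
           (use t eq in \<open>auto intro!: eventually_mono[OF eventually_at_right_real[of 0 "b - t"]]\<close>)
    qed
  qed
  from lipschitz_right_derivative_has_bochner_integral[OF \<open>a < b\<close> lipF this]
  show ?thesis using ab by (simp add: F_def)
qed

theorem theorem22p1:
  fixes J T :: "real set" and f g :: "real \<Rightarrow> 'a::banach"
  assumes "open J" and "is_interval J"
    and "right_antiderivative_on f g J"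
    and "T \<in> null_sets lebesgue" and "locally_bounded_off g J T"
  shows "(\<forall>t1 t2. t1 \<le> t2 \<and> {t1..t2} \<subseteq> J \<longrightarrow> bochner_summable_on g {t1..t2}) \<and>
    (\<forall>t1\<in>J. \<forall>t2\<in>J. oriented_bochner_integral t1 t2 g = f t2 - f t1)"
proof (intro conjI allI ballI impI)
  note int = right_antiderivative_on_has_bochner_integral[OF assms(3-5)]
  show "bochner_summable_on g {t1..t2}" if "t1 \<le> t2 \<and> {t1..t2} \<subseteq> J" for t1 t2
    unfolding bochner_summable_on_def using int that by blast
  have val: "bochner_integral_on g {a..b} = f b - f a" if "a \<in> J" "b \<in> J" "a \<le> b" for a b
  proof -
    \<comment> \<open>Only here is the interval property of \<open>J\<close> used: it places the
      whole segment between two points inside \<open>J\<close>.\<close>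
    have "{a..b} \<subseteq> J"
      using mem_is_interval_1_I[OF assms(2) that(1,2)] by auto
    then show ?thesis
      by (rule bochner_integral_on_eqI[OF int[OF that(3)]])
  qed
  show "oriented_bochner_integral t1 t2 g = f t2 - f t1" if "t1 \<in> J" "t2 \<in> J" for t1 t2
    using val[OF that] val[OF that(2,1)] by (simp add: oriented_bochner_integral_def)
qed

end
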